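(* Let $\mu$ be a Borel probability measure on $\mathbb{T}=\mathbb{R}/\mathbb{Z}$ and let $(a_n)_{n\in\mathbb{Z}}$ be real or complex numbers. Assume that for some constants $K>0$ and $a\ge0$, $$|\hat\mu(n)|\le K|n|^{-a}\quad\text{for all integers } n\ne0 .$$ If there exists $b>(1-a)/2$ such that $$\sum_{n\in\mathbb{Z}}|a_n|^2|n|^{2b}\log_2^2(|n|+1)<\infty,$$ then the trigonometric series $\sum_{n\in\mathbb{Z}}a_n\exp(2\pi i n t)$ converges $\mu$-almost everywhere on $\mathbb{T}$.
   Context: $\hat\mu(n)=\int_{\mathbb{T}}\exp(2\pi i n x)\,d\mu(x)$ for $n\in\mathbb{Z}$. $\log_2$ is the base-2 logarithm and $\log_2^2(x)=(\log_2x)^2$; the $n=0$ term of the summability condition is read as $0$. Convergence of the trigonometric series over $n\in\mathbb{Z}$ is understood as convergence of the symmetric partial sums $\sum_{|n|\le N}$ as $N\to\infty$.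
   Formalization: The condition b ≥ 0 is added. It is automatic for a ≤ 1; for a > 1 the claim with b < 0 is false: Lebesgue measure, a = 4, b = -1, a_n = 1 satisfies every hypothesis, yet the series diverges everywhere. *)

theory Defs
  imports "HOL-Probability.Probability"
begin

text \<open>The circle group \<open>\<real>/\<int>\<close>, as a set of cosets.\<close>

quotient_type torus = real / "\<lambda>x y::real. x - y \<in> \<int>"
  morphisms rep_torus to_torus
proof (rule equivpI)
  show "reflp (\<lambda>x y::real. x - y \<in> \<int>)"
    by (simp add: reflp_def)
  show "symp (\<lambda>x y::real. x - y \<in> \<int>)"
  proof (rule sympI)
    fix x y :: real
    assume "x - y \<in> \<int>"
    then have "- (x - y) \<in> \<int>"
      by (rule Ints_minus)
    then show "y - x \<in> \<int>"
      by simp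
  qed
  show "transp (\<lambda>x y::real. x - y \<in> \<int>)"
  proof (rule transpI)
    fix x y z :: real
    assume "x - y \<in> \<int>" and "y - z \<in> \<int>"
    then have "(x - y) + (y - z) \<in> \<int>"
      by (rule Ints_add)
    then show "x - z \<in> \<int>"
      by simp
  qed
qed

text \<open>The quotient topology; it determines \<open>borel :: torus measure\<close>.\<close>

instantiation torus :: topological_space
begin

definition open_torus :: "torus set \<Rightarrow> bool" where
  "open_torus U \<longleftrightarrow> open (to_torus -` U)"

instance
proof
  show "open (UNIV :: torus set)"
    by (simp add: open_torus_def)
  show "open (S \<inter> T)" if "open S" and "open T" for S T :: "torus set"
    using that by (simp add: open_torus_def vimage_Int open_Int)
  show "open (\<Union>K)" if "\<forall>S\<in>K. open S" for K :: "torus set set"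
    using that by (auto simp: open_torus_def vimage_Union)
qed

end

lift_definition character :: "int \<Rightarrow> torus \<Rightarrow> complex"
  is "\<lambda>n x. exp (2 * of_real pi * \<i> * of_int n * of_real x)"
proof -
  fix n :: int and x y :: real
  assume "x - y \<in> \<int>"
  then obtain k :: int where "x - y = of_int k"
    by (rule Ints_cases)
  then have k: "x = y + of_int k"
    by linarith
  have "2 * of_real pi * \<i> * of_int n * of_real x =
      2 * of_real pi * \<i> * of_int n * of_real y + 2 * of_real pi * \<i> * of_int (n * k)"
    by (simp only: k of_real_add of_real_of_int_eq of_int_mult distrib_left mult.assoc)
  moreover have "exp (2 * of_real pi * \<i> * of_int (n * k)) = 1"
    using exp_integer_2pi[OF Ints_of_int, of "n * k"]
    by (simp only: of_real_mult of_real_numeral of_real_of_int_eq of_int_mult mult_ac)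
  ultimately show "exp (2 * of_real pi * \<i> * of_int n * of_real x) =
      exp (2 * of_real pi * \<i> * of_int n * of_real y)"
    by (simp only: exp_add mult_1_right)
qed

lemma continuous_on_character: "continuous_on UNIV (character n)"
proof (subst continuous_on_open_vimage[OF open_UNIV], intro allI impI)
  fix B :: "complex set"
  assume "open B"
  have "continuous_on UNIV (\<lambda>x::real. exp (2 * of_real pi * \<i> * of_int n * of_real x))"
    by (intro continuous_intros)
  then have "open ((\<lambda>x::real. exp (2 * of_real pi * \<i> * of_int n * of_real x)) -` B)"
    using \<open>open B\<close> by (simp add: continuous_on_open_vimage)
  moreover have "to_torus -` (character n -` B \<inter> UNIV) =
      (\<lambda>x::real. exp (2 * of_real pi * \<i> * of_int n * of_real x)) -` B"
    by (simp add: vimage_def character.abs_eq)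
  ultimately show "open (character n -` B \<inter> UNIV)"
    by (simp add: open_torus_def)
qed

definition fourier_coeff :: "torus measure \<Rightarrow> int \<Rightarrow> complex" where
  "fourier_coeff \<mu> n = (\<integral>x. character n x \<partial>\<mu>)"

end

theory Submission
  imports Defs "HOL-Library.Discrete_Functions"
begin

text \<open>
  The proof is the Rademacher--Menshov argument, with orthogonality of the characters in
  \<open>L\<^sup>2(\<mu>)\<close> replaced by a quantitative substitute on each dyadic range of frequencies.

  The inner product of two characters in \<open>L\<^sup>2(\<mu>)\<close> is a Fourier coefficient of \<open>\<mu>\<close> at the
  difference of the frequencies. By Schur's test, the squared \<open>L\<^sup>2(\<mu>)\<close> norm of a trigonometric sum
  with frequencies of modulus below \<open>2\<^bsup>k + 1\<^esup>\<close> is therefore at most \<open>A\<^sub>k\<close> times the sum of the squared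
  moduli of its coefficients, where \<open>A\<^sub>k\<close> is the sum of \<open>\<bar>fourier_coeff \<mu> j\<bar>\<close> over
  \<open>\<bar>j\<bar> \<le> 2\<^bsup>k + 2\<^esup>\<close> (\<open>integral_norm_square_trigonometric_sum_le\<close>). With \<open>e = 2 * b + a > 1\<close> one has
  \<open>j\<^bsup>-a\<^esup> = j\<^bsup>2b\<^esup> j\<^bsup>-e\<^esup>\<close>; since \<open>b \<ge> 0\<close>, the first factor is at most its value at the end of the
  range, and the second is summable. Hence \<open>A\<^sub>k\<close> is at most a constant times \<open>2\<^bsup>2bk\<^esup>\<close>
  (\<open>sum_fourier_coeff_le\<close>): the weight \<open>\<bar>n\<bar>\<^bsup>2b\<^esup>\<close> of the hypothesis pays exactly for the failure of
  orthogonality.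

  What remains holds over any measure space (\<open>Rademacher_Menshov_dyadic_blocks\<close>). Within the
  \<open>k\<close>-th dyadic block, all partial sums are dominated by one integrable function, at the cost of a
  factor \<open>(k + 1)\<^sup>2\<close>, and \<open>k + 1 \<le> 2 * log 2 (\<bar>n\<bar> + 1)\<close> there: this is what the squared logarithm
  pays for. So these dominating functions have a convergent sum almost everywhere and tend to \<open>0\<close>,
  and the same factor \<open>(k + 1)\<^sup>2\<close> makes the sums over full blocks absolutely summable. Grouping the
  frequencies \<open>n\<close> and \<open>-n\<close> into one term turns symmetric partial sums into ordinary ones.
\<close>

section \<open>The maximal inequality on a dyadic block\<close>

text \<open>
  The sum of \<open>(norm (\<Sum>n\<in>I. z n))\<^sup>2\<close> over all intervals \<open>I\<close> obtained from \<open>{s..<s + 2 ^ k}\<close> by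
  repeated halving. Its integral involves only the few intervals of this binary tree, while it
  controls every initial sum.
\<close>

fun dyadic_energy :: "(nat \<Rightarrow> 'a::real_normed_vector) \<Rightarrow> nat \<Rightarrow> nat \<Rightarrow> real" where
  "dyadic_energy z 0 s = (norm (z s))\<^sup>2"
| "dyadic_energy z (Suc k) s =
     (norm (\<Sum>n=s..<s + 2 ^ Suc k. z n))\<^sup>2 + dyadic_energy z k s + dyadic_energy z k (s + 2 ^ k)"

lemma dyadic_energy_nonneg: "0 \<le> dyadic_energy z k s"
  by (induction k arbitrary: s) auto

lemma dyadic_energy_ge_block:
  "(norm (\<Sum>n=s..<s + 2 ^ k. z n))\<^sup>2 \<le> dyadic_energy z k s"
  by (cases k) (auto simp: dyadic_energy_nonneg)

text \<open>
  Cauchy--Schwarz with weights \<open>1\<close> and \<open>t\<close>. Taking \<open>t\<close> to be the number of dyadic pieces collected in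
  \<open>y\<close> makes the constant below grow by one per level instead of doubling.
\<close>

lemma weighted_square_sum:
  fixes x y t :: real
  assumes "t > 0"
  shows "(x + y)\<^sup>2 \<le> (t + 1) * (x\<^sup>2 + y\<^sup>2 / t)"
proof -
  have "(t + 1) * (x\<^sup>2 + y\<^sup>2 / t) - (x + y)\<^sup>2 = (t * x - y)\<^sup>2 / t"
    using assms by (simp add: field_simps power2_eq_square)
  also have "\<dots> \<ge> 0" using assms by simp
  finally show ?thesis by linarith
qed

text \<open>
  By binary expansion of \<open>j\<close>, the interval \<open>{s..<s + j}\<close> splits into at most \<open>k + 1\<close> intervals of
  the halving tree, at most one per level. The right-hand side does not depend on \<open>j\<close>, so that it bounds
  the maximal function.
\<close>

lemma partial_sum_le_dyadic_energy:
  assumes "j \<le> 2 ^ k"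
  shows "(norm (\<Sum>n=s..<s + j. z n))\<^sup>2 \<le> (real k + 1) * dyadic_energy z k s"
  using assms
proof (induction k arbitrary: s j)
  case 0
  then consider "j = 0" | "j = 1" by fastforce
  then show ?case by cases auto
next
  case (Suc k)
  let ?E = "dyadic_energy z k s" and ?E' = "dyadic_energy z k (s + 2 ^ k)"
  show ?case
  proof (cases "j \<le> 2 ^ k")
    case True
    have "(norm (\<Sum>n=s..<s + j. z n))\<^sup>2 \<le> (real k + 1) * ?E"
      using Suc.IH True by blast
    also have "\<dots> \<le> (real (Suc k) + 1) * dyadic_energy z (Suc k) s"
      by (intro mult_mono) (auto simp: dyadic_energy_nonneg)
    finally show ?thesis .
  next
    case False
    define i where "i = j - 2 ^ k"
    have j: "j = 2 ^ k + i" and i: "i \<le> 2 ^ k" using False Suc.prems by (auto simp: i_def)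
    let ?B = "\<Sum>n=s..<s + 2 ^ k. z n" and ?T = "\<Sum>n=s + 2 ^ k..<s + 2 ^ k + i. z n"
    have "(\<Sum>n=s..<s + j. z n) = ?B + ?T"
      unfolding j by (simp add: sum.atLeastLessThan_concat add.assoc)
    then have "(norm (\<Sum>n=s..<s + j. z n))\<^sup>2 \<le> (norm ?B + norm ?T)\<^sup>2"
      by (simp add: power_mono norm_triangle_ineq)
    also have "\<dots> \<le> (real k + 1 + 1) * ((norm ?B)\<^sup>2 + (norm ?T)\<^sup>2 / (real k + 1))"
      by (rule weighted_square_sum) simp
    also have "\<dots> \<le> (real k + 1 + 1) * (?E + ?E')"
    proof (intro mult_left_mono add_mono)
      show "(norm ?B)\<^sup>2 \<le> ?E" by (rule dyadic_energy_ge_block)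
      show "(norm ?T)\<^sup>2 / (real k + 1) \<le> ?E'"
        using Suc.IH[OF i, of "s + 2 ^ k"] by (simp add: field_simps)
    qed simp
    also have "\<dots> \<le> (real (Suc k) + 1) * dyadic_energy z (Suc k) s"
      by (intro mult_mono) (auto simp: dyadic_energy_nonneg)
    finally show ?thesis .
  qed
qed

text \<open>
  The tree has \<open>k + 1\<close> levels, and the intervals of each level partition \<open>{s..<s + 2 ^ k}\<close>, so each
  level contributes at most \<open>A * (\<Sum>n=s..<s + 2 ^ k. w n)\<close>. The outer range from \<open>l\<close> to \<open>u\<close> stays fixed
  while the induction moves \<open>s\<close>.
\<close>

lemma integral_dyadic_energy_le:
  fixes f :: "nat \<Rightarrow> 'x \<Rightarrow> 'a::real_normed_vector" and w :: "nat \<Rightarrow> real"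
  assumes int: "\<And>m p. integrable M (\<lambda>x. (norm (\<Sum>n=m..<p. f n x))\<^sup>2)"
    and bound: "\<And>m p. l \<le> m \<Longrightarrow> p \<le> u \<Longrightarrow>
      (\<integral>x. (norm (\<Sum>n=m..<p. f n x))\<^sup>2 \<partial>M) \<le> A * (\<Sum>n=m..<p. w n)"
    and "l \<le> s" and "s + 2 ^ k \<le> u"
  shows "integrable M (\<lambda>x. dyadic_energy (\<lambda>n. f n x) k s)"
    and "(\<integral>x. dyadic_energy (\<lambda>n. f n x) k s \<partial>M) \<le> (real k + 1) * (A * (\<Sum>n=s..<s + 2 ^ k. w n))"
proof -
  have "integrable M (\<lambda>x. dyadic_energy (\<lambda>n. f n x) k s) \<and>
    (\<integral>x. dyadic_energy (\<lambda>n. f n x) k s \<partial>M) \<le> (real k + 1) * (A * (\<Sum>n=s..<s + 2 ^ k. w n))"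
    using \<open>l \<le> s\<close> \<open>s + 2 ^ k \<le> u\<close>
  proof (induction k arbitrary: s)
    case 0
    then show ?case using int[of s "Suc s"] bound[of s "Suc s"] by simp
  next
    case (Suc k)
    let ?m = "s + 2 ^ k" and ?p = "s + 2 ^ Suc k"
    note IH1 = Suc.IH[of s] and IH2 = Suc.IH[of ?m]
    have i1: "integrable M (\<lambda>x. dyadic_energy (\<lambda>n. f n x) k s)"
      and i2: "integrable M (\<lambda>x. dyadic_energy (\<lambda>n. f n x) k ?m)"
      using IH1 IH2 Suc.prems by auto
    have split: "(\<Sum>n=s..<?m. w n) + (\<Sum>n=?m..<?m + 2 ^ k. w n) = (\<Sum>n=s..<?p. w n)"
      by (subst sum.atLeastLessThan_concat) (auto simp: mult_2 add.assoc)
    have "(\<integral>x. dyadic_energy (\<lambda>n. f n x) (Suc k) s \<partial>M) =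
        (\<integral>x. (norm (\<Sum>n=s..<?p. f n x))\<^sup>2 \<partial>M) + (\<integral>x. dyadic_energy (\<lambda>n. f n x) k s \<partial>M)
        + (\<integral>x. dyadic_energy (\<lambda>n. f n x) k ?m \<partial>M)"
      unfolding dyadic_energy.simps
      by (subst Bochner_Integration.integral_add, intro Bochner_Integration.integrable_add int i1, rule i2)
        (subst Bochner_Integration.integral_add, rule int, rule i1, rule refl)
    also have "\<dots> \<le> A * (\<Sum>n=s..<?p. w n) + (real k + 1) * (A * (\<Sum>n=s..<?m. w n))
        + (real k + 1) * (A * (\<Sum>n=?m..<?m + 2 ^ k. w n))"
      using IH1 IH2 Suc.prems by (intro add_mono bound) auto
    also have "\<dots> = (real (Suc k) + 1) * (A * (\<Sum>n=s..<?p. w n))"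
      unfolding split[symmetric] by (simp add: algebra_simps)
    finally show ?case
      using int i1 i2 by auto
  qed
  then show "integrable M (\<lambda>x. dyadic_energy (\<lambda>n. f n x) k s)"
    and "(\<integral>x. dyadic_energy (\<lambda>n. f n x) k s \<partial>M) \<le> (real k + 1) * (A * (\<Sum>n=s..<s + 2 ^ k. w n))"
    by auto
qed

section \<open>Almost everywhere convergence from dyadic blocks\<close>

lemma AE_summable_of_summable_integrals:
  fixes g :: "nat \<Rightarrow> 'x \<Rightarrow> real"
  assumes int: "\<And>k. integrable M (g k)" and pos: "\<And>k x. 0 \<le> g k x"
    and sum: "summable (\<lambda>k. \<integral>x. g k x \<partial>M)"
  shows "AE x in M. summable (\<lambda>k. g k x)"
proof -
  have [measurable]: "g k \<in> borel_measurable M" for k using int by auto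
  have "(\<integral>\<^sup>+x. (\<Sum>k. ennreal (g k x)) \<partial>M) = (\<Sum>k. \<integral>\<^sup>+x. ennreal (g k x) \<partial>M)"
    by (rule nn_integral_suminf) auto
  also have "\<dots> = (\<Sum>k. ennreal (\<integral>x. g k x \<partial>M))"
    by (subst nn_integral_eq_integral[OF int]) (auto simp: pos)
  also have "\<dots> \<noteq> \<infinity>"
    using sum by (subst suminf_ennreal2) (auto simp: pos)
  finally have "AE x in M. (\<Sum>k. ennreal (g k x)) \<noteq> \<infinity>"
    by (intro nn_integral_PInf_AE) auto
  then show ?thesis
    by eventually_elim (auto intro: summable_suminf_not_top simp: pos)
qed

text \<open>
  The values at powers of two converge because their increments are summable, and \<open>h\<close> controls
  how far the sequence strays from the last power of two, which is \<open>2 ^ floor_log p\<close> at index \<open>p\<close>.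
\<close>

lemma convergent_of_dyadic_control:
  fixes S :: "nat \<Rightarrow> 'a::banach"
  assumes D: "summable (\<lambda>k. norm (S (2 ^ Suc k) - S (2 ^ k)))"
    and h: "h \<longlonglongrightarrow> 0"
    and osc: "\<And>k p. 2 ^ k \<le> p \<Longrightarrow> p < 2 ^ Suc k \<Longrightarrow> (norm (S p - S (2 ^ k)))\<^sup>2 \<le> h k"
  shows "convergent S"
proof -
  have "summable (\<lambda>k. S (2 ^ Suc k) - S (2 ^ k))"
    using D by (rule summable_norm_cancel)
  then have "convergent (\<lambda>N. \<Sum>k<N. S (2 ^ Suc k) - S (2 ^ k))"
    by (simp only: summable_iff_convergent)
  then have "convergent (\<lambda>N. S (2 ^ N) - S (2 ^ 0))"
    using sum_lessThan_telescope[of "\<lambda>k. S (2 ^ k)"] by simp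
  then have "convergent (\<lambda>N. S (2 ^ N))"
    by (simp add: convergent_diff_const_right_iff)
  then obtain L where L: "(\<lambda>N. S (2 ^ N)) \<longlonglongrightarrow> L" by (auto simp: convergent_def)
  have fl: "filterlim floor_log at_top at_top"
  proof (subst filterlim_at_top, intro allI)
    fix Z :: nat
    show "\<forall>\<^sub>F p in at_top. Z \<le> floor_log p"
      using eventually_ge_at_top[of "2 ^ Z"]
    proof eventually_elim
      case (elim p)
      then show ?case using floor_log_mono[THEN monoD, OF elim] by simp
    qed
  qed
  have sh: "(\<lambda>k. sqrt (h k)) \<longlonglongrightarrow> 0"
    using tendsto_real_sqrt[OF h] by simp
  have "(\<lambda>p. S p - S (2 ^ floor_log p)) \<longlonglongrightarrow> 0"
  proof (rule Lim_null_comparison)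
    show "\<forall>\<^sub>F p in sequentially. norm (S p - S (2 ^ floor_log p)) \<le> sqrt (h (floor_log p))"
      using eventually_gt_at_top[of 0]
    proof eventually_elim
      case (elim p)
      show ?case
        by (intro real_le_rsqrt osc)
          (use elim floor_log_exp2_le floor_log_exp2_gt in \<open>auto\<close>)
    qed
    show "(\<lambda>p. sqrt (h (floor_log p))) \<longlonglongrightarrow> 0"
      by (rule filterlim_compose[OF sh fl])
  qed
  moreover have "(\<lambda>p. S (2 ^ floor_log p)) \<longlonglongrightarrow> L"
    by (rule filterlim_compose[OF L fl])
  ultimately have "(\<lambda>p. (S p - S (2 ^ floor_log p)) + S (2 ^ floor_log p)) \<longlonglongrightarrow> 0 + L"
    by (rule tendsto_add)
  then show ?thesis by (auto simp: convergent_def)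
qed

text \<open>
  One factor \<open>k + 1\<close> of the summability hypothesis comes from the pointwise bound of partial sums by the
  dyadic energy, the other from the number of levels in its integral. For the sums \<open>D k\<close>
  over full blocks no maximal function is needed, and the whole factor \<open>(k + 1)\<^sup>2\<close> serves to turn
  square summability into absolute summability.
\<close>

theorem Rademacher_Menshov_dyadic_blocks:
  fixes f :: "nat \<Rightarrow> 'x \<Rightarrow> 'a::banach" and w :: "nat \<Rightarrow> real" and A :: "nat \<Rightarrow> real"
  assumes int: "\<And>m p. integrable M (\<lambda>x. (norm (\<Sum>n=m..<p. f n x))\<^sup>2)"
    and bound: "\<And>k m p. 2 ^ k \<le> m \<Longrightarrow> p \<le> 2 ^ Suc k \<Longrightarrow>
      (\<integral>x. (norm (\<Sum>n=m..<p. f n x))\<^sup>2 \<partial>M) \<le> A k * (\<Sum>n=m..<p. w n)"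
    and sum: "summable (\<lambda>k. (real k + 1)\<^sup>2 * (A k * (\<Sum>n=2 ^ k..<2 ^ Suc k. w n)))"
  shows "AE x in M. convergent (\<lambda>N. \<Sum>n<N. f n x)"
proof -
  define D where "D k x = (\<Sum>n=2 ^ k..<2 ^ Suc k. f n x)" for k x
  define H where "H k x = (real k + 1) * dyadic_energy (\<lambda>n. f n x) k (2 ^ k)" for k x
  have energy: "integrable M (\<lambda>x. dyadic_energy (\<lambda>n. f n x) k (2 ^ k))"
    "(\<integral>x. dyadic_energy (\<lambda>n. f n x) k (2 ^ k) \<partial>M)
      \<le> (real k + 1) * (A k * (\<Sum>n=2 ^ k..<2 ^ k + 2 ^ k. w n))" for k
    by (rule integral_dyadic_energy_le[where l = "2 ^ k" and u = "2 ^ Suc k" and A = "A k" and w = w];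
        use int bound in auto)+
  have "AE x in M. summable (\<lambda>k. H k x)"
  proof (rule AE_summable_of_summable_integrals)
    show "integrable M (H k)" for k
      unfolding H_def using energy(1) by simp
    show "0 \<le> H k x" for k x
      unfolding H_def by (simp add: dyadic_energy_nonneg)
    show "summable (\<lambda>k. \<integral>x. H k x \<partial>M)"
    proof (rule summable_comparison_test'[OF sum, of 0])
      fix k :: nat
      have "norm (\<integral>x. H k x \<partial>M) = (\<integral>x. H k x \<partial>M)"
        unfolding H_def by (simp add: dyadic_energy_nonneg)
      also have "\<dots> = (real k + 1) * (\<integral>x. dyadic_energy (\<lambda>n. f n x) k (2 ^ k) \<partial>M)"
        unfolding H_def by simp
      also have "\<dots> \<le> (real k + 1) * ((real k + 1) * (A k * (\<Sum>n=2 ^ k..<2 ^ k + 2 ^ k. w n)))"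
        by (intro mult_left_mono energy) auto
      also have "\<dots> = (real k + 1)\<^sup>2 * (A k * (\<Sum>n=2 ^ k..<2 ^ Suc k. w n))"
        by (simp add: power2_eq_square mult_2)
      finally show "norm (\<integral>x. H k x \<partial>M) \<le> (real k + 1)\<^sup>2 * (A k * (\<Sum>n=2 ^ k..<2 ^ Suc k. w n))" .
    qed
  qed
  moreover have "AE x in M. summable (\<lambda>k. (real k + 1)\<^sup>2 * (norm (D k x))\<^sup>2)"
  proof (rule AE_summable_of_summable_integrals)
    show "integrable M (\<lambda>x. (real k + 1)\<^sup>2 * (norm (D k x))\<^sup>2)" for k
      unfolding D_def by (intro integrable_mult_right int)
    show "summable (\<lambda>k. \<integral>x. (real k + 1)\<^sup>2 * (norm (D k x))\<^sup>2 \<partial>M)"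
    proof (rule summable_comparison_test'[OF sum, of 0])
      fix k :: nat
      have "norm (\<integral>x. (real k + 1)\<^sup>2 * (norm (D k x))\<^sup>2 \<partial>M)
          = (real k + 1)\<^sup>2 * (\<integral>x. (norm (D k x))\<^sup>2 \<partial>M)"
        by simp
      also have "\<dots> \<le> (real k + 1)\<^sup>2 * (A k * (\<Sum>n=2 ^ k..<2 ^ Suc k. w n))"
        unfolding D_def by (intro mult_left_mono bound) auto
      finally show "norm (\<integral>x. (real k + 1)\<^sup>2 * (norm (D k x))\<^sup>2 \<partial>M)
        \<le> (real k + 1)\<^sup>2 * (A k * (\<Sum>n=2 ^ k..<2 ^ Suc k. w n))" .
    qed
  qed simp
  ultimately show ?thesis
  proof eventually_elim
    case (elim x)
    let ?S = "\<lambda>N. \<Sum>n<N. f n x"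
    have diff: "?S p - ?S m = (\<Sum>n=m..<p. f n x)" if "m \<le> p" for m p
      using sum_diff_nat_ivl[of 0 m p "\<lambda>n. f n x"] that by (simp add: atLeast0LessThan)
    show ?case
    proof (rule convergent_of_dyadic_control[where h = "\<lambda>k. H k x"])
      have "summable (\<lambda>k. 1 / (real k + 1)\<^sup>2)"
        using inverse_power_summable[of 2, where 'a = real, THEN summable_ignore_initial_segment, of 1]
        by (simp add: field_simps)
      then have "summable (\<lambda>k. 1 / (real k + 1)\<^sup>2 + (real k + 1)\<^sup>2 * (norm (D k x))\<^sup>2)"
        using elim(2) by (rule summable_add)
      then show "summable (\<lambda>k. norm (?S (2 ^ Suc k) - ?S (2 ^ k)))"
      proof (rule summable_comparison_test'[where N = 0])
        fix k :: nat
        \<comment> \<open>AM-GM after writing \<open>norm (D k x)\<close> as the product of \<open>1 / (k + 1)\<close> and \<open>(k + 1) * norm (D k x)\<close>,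
          both of which are square summable\<close>
        define r where "r = (real k + 1) * norm (D k x)"
        have "norm (D k x) = 1 / (real k + 1) * r" by (simp add: r_def)
        also have "\<dots> \<le> (1 / (real k + 1))\<^sup>2 + r\<^sup>2"
        proof -
          have "2 * (1 / (real k + 1)) * r \<le> (1 / (real k + 1))\<^sup>2 + r\<^sup>2"
            by (rule sum_squares_bound)
          moreover have "0 \<le> 1 / (real k + 1) * r" by (simp add: r_def)
          ultimately show ?thesis by linarith
        qed
        finally have "norm (D k x) \<le> 1 / (real k + 1)\<^sup>2 + (real k + 1)\<^sup>2 * (norm (D k x))\<^sup>2"
          by (simp add: r_def power_mult_distrib power_divide)
        then show "norm (norm (?S (2 ^ Suc k) - ?S (2 ^ k)))
            \<le> 1 / (real k + 1)\<^sup>2 + (real k + 1)\<^sup>2 * (norm (D k x))\<^sup>2"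
          by (subst diff) (auto simp: D_def)
      qed
      show "(\<lambda>k. H k x) \<longlonglongrightarrow> 0"
        using elim(1) by (rule summable_LIMSEQ_zero)
      fix k p :: nat
      assume p: "2 ^ k \<le> p" "p < 2 ^ Suc k"
      then have "(norm (\<Sum>n=2 ^ k..<2 ^ k + (p - 2 ^ k). f n x))\<^sup>2 \<le> H k x"
        unfolding H_def by (intro partial_sum_le_dyadic_energy) auto
      then show "(norm (?S p - ?S (2 ^ k)))\<^sup>2 \<le> H k x"
        using p by (subst diff) auto
    qed
  qed
qed

section \<open>Near-orthogonality of characters\<close>

lemma norm_character [simp]: "norm (character n t) = 1"
proof (transfer)
  fix n :: int and x :: real
  have "2 * of_real pi * \<i> * of_int n * of_real x = \<i> * of_real (2 * pi * of_int n * x)"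
    by simp
  then show "norm (exp (2 * of_real pi * \<i> * of_int n * of_real x)) = 1"
    by (simp only: norm_exp_i_times)
qed

lemma character_mult_cnj: "character n t * cnj (character m t) = character (n - m) t"
proof (transfer)
  fix n m :: int and x :: real
  show "exp (2 * of_real pi * \<i> * of_int n * of_real x)
      * cnj (exp (2 * of_real pi * \<i> * of_int m * of_real x))
      = exp (2 * of_real pi * \<i> * of_int (n - m) * of_real x)"
    by (simp add: exp_cnj flip: exp_add) (simp add: algebra_simps)
qed

context
  fixes \<mu> :: "torus measure"
  assumes prob: "prob_space \<mu>" and sets: "sets \<mu> = sets borel"
begin

interpretation prob_space \<mu> by (rule prob)

lemma measurable_character [measurable]: "character n \<in> borel_measurable \<mu>"
  using borel_measurable_continuous_onI[OF continuous_on_character[of n]]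
  by (simp add: measurable_cong_sets[OF sets refl])

lemma integrable_character: "integrable \<mu> (character n)"
  by (rule integrable_const_bound[of _ 1]) auto

lemma integrable_norm_square_trigonometric_sum:
  "integrable \<mu> (\<lambda>t. (norm (\<Sum>i\<in>F. d i * character i t))\<^sup>2)"
proof (rule integrable_const_bound[of _ "(\<Sum>i\<in>F. norm (d i))\<^sup>2"])
  show "AE t in \<mu>. norm ((norm (\<Sum>i\<in>F. d i * character i t))\<^sup>2) \<le> (\<Sum>i\<in>F. norm (d i))\<^sup>2"
    by (intro AE_I2) (auto intro!: power_mono sum_norm_le simp: norm_mult)
qed auto

text \<open>
  Schur's test for the Gram matrix \<open>fourier_coeff \<mu> (i - j)\<close>: after
  \<open>\<bar>d i\<bar> * \<bar>d j\<bar> \<le> (\<bar>d i\<bar>\<^sup>2 + \<bar>d j\<bar>\<^sup>2) / 2\<close>, every row and every column sum of moduli runs over distinct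
  differences in \<open>{-R..R}\<close>.
\<close>

lemma integral_norm_square_trigonometric_sum_le:
  assumes "finite F" and R: "\<And>i j. i \<in> F \<Longrightarrow> j \<in> F \<Longrightarrow> \<bar>i - j\<bar> \<le> R"
  shows "(\<integral>t. (norm (\<Sum>i\<in>F. d i * character i t))\<^sup>2 \<partial>\<mu>)
    \<le> (\<Sum>j=-R..R. norm (fourier_coeff \<mu> j)) * (\<Sum>i\<in>F. (norm (d i))\<^sup>2)"
proof -
  define Q where "Q = (\<Sum>j=-R..R. norm (fourier_coeff \<mu> j))"
  let ?\<phi> = "\<lambda>j. norm (fourier_coeff \<mu> j)"
  have sq: "of_real ((norm (\<Sum>i\<in>F. d i * character i t))\<^sup>2)
      = (\<Sum>i\<in>F. \<Sum>j\<in>F. d i * cnj (d j) * character (i - j) t)" for t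
    unfolding complex_norm_square cnj_sum sum_product
    by (intro sum.cong refl) (simp flip: character_mult_cnj)
  have "of_real (\<integral>t. (norm (\<Sum>i\<in>F. d i * character i t))\<^sup>2 \<partial>\<mu>)
      = (\<integral>t. (\<Sum>i\<in>F. \<Sum>j\<in>F. d i * cnj (d j) * character (i - j) t) \<partial>\<mu>)"
    by (simp only: integral_complex_of_real[symmetric] sq)
  also have "\<dots> = (\<Sum>i\<in>F. \<Sum>j\<in>F. d i * cnj (d j) * fourier_coeff \<mu> (i - j))"
    by (simp add: Bochner_Integration.integral_sum integrable_character fourier_coeff_def)
  finally have "norm (complex_of_real (\<integral>t. (norm (\<Sum>i\<in>F. d i * character i t))\<^sup>2 \<partial>\<mu>))
      = norm (\<Sum>i\<in>F. \<Sum>j\<in>F. d i * cnj (d j) * fourier_coeff \<mu> (i - j))"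
    by (rule arg_cong)
  then have "\<bar>\<integral>t. (norm (\<Sum>i\<in>F. d i * character i t))\<^sup>2 \<partial>\<mu>\<bar>
      = norm (\<Sum>i\<in>F. \<Sum>j\<in>F. d i * cnj (d j) * fourier_coeff \<mu> (i - j))"
    by (simp only: norm_of_real)
  also have "\<dots> \<le> (\<Sum>i\<in>F. \<Sum>j\<in>F. norm (d i) * norm (d j) * ?\<phi> (i - j))"
    by (intro sum_norm_le) (simp add: norm_mult)
  also have "\<dots> \<le> (\<Sum>i\<in>F. \<Sum>j\<in>F. ((norm (d i))\<^sup>2 / 2 + (norm (d j))\<^sup>2 / 2) * ?\<phi> (i - j))"
  proof (intro sum_mono mult_right_mono)
    fix i j
    show "norm (d i) * norm (d j) \<le> (norm (d i))\<^sup>2 / 2 + (norm (d j))\<^sup>2 / 2"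
      using sum_squares_bound[of "norm (d i)" "norm (d j)"] by simp
  qed auto
  also have "\<dots> = (\<Sum>i\<in>F. (norm (d i))\<^sup>2 / 2 * (\<Sum>j\<in>F. ?\<phi> (i - j)))
      + (\<Sum>j\<in>F. (norm (d j))\<^sup>2 / 2 * (\<Sum>i\<in>F. ?\<phi> (i - j)))"
    unfolding distrib_right sum.distrib sum_distrib_left
    by (subst (2) sum.swap) (rule refl)
  also have "\<dots> \<le> (\<Sum>i\<in>F. (norm (d i))\<^sup>2 / 2 * Q) + (\<Sum>j\<in>F. (norm (d j))\<^sup>2 / 2 * Q)"
  proof (intro add_mono sum_mono mult_left_mono)
    fix i assume i: "i \<in> F"
    have "(\<Sum>j\<in>F. ?\<phi> (i - j)) = sum ?\<phi> ((\<lambda>j. i - j) ` F)"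
      by (subst sum.reindex) (auto simp: inj_on_def)
    also have "\<dots> \<le> Q"
    proof (unfold Q_def, rule sum_mono2)
      show "(\<lambda>j. i - j) ` F \<subseteq> {-R..R}"
      proof (rule image_subsetI)
        fix j assume "j \<in> F"
        then have "\<bar>i - j\<bar> \<le> R" using R i by blast
        then show "i - j \<in> {-R..R}" by auto
      qed
    qed auto
    finally show "(\<Sum>j\<in>F. ?\<phi> (i - j)) \<le> Q" .
    have "(\<Sum>j\<in>F. ?\<phi> (j - i)) = sum ?\<phi> ((\<lambda>j. j - i) ` F)"
      by (subst sum.reindex) (auto simp: inj_on_def)
    also have "\<dots> \<le> Q"
    proof (unfold Q_def, rule sum_mono2)
      show "(\<lambda>j. j - i) ` F \<subseteq> {-R..R}"
      proof (rule image_subsetI)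
        fix j assume "j \<in> F"
        then have "\<bar>i - j\<bar> \<le> R" using R i by blast
        then show "j - i \<in> {-R..R}" by auto
      qed
    qed auto
    finally show "(\<Sum>j\<in>F. ?\<phi> (j - i)) \<le> Q" .
  qed auto
  also have "\<dots> = Q * (\<Sum>i\<in>F. (norm (d i))\<^sup>2)"
    by (simp add: sum_distrib_left mult.commute flip: sum.distrib)
  finally show ?thesis unfolding Q_def by simp
qed

end

text \<open>
  Splitting the exponent as \<open>-a = 2 * b - e\<close> with \<open>e > 1\<close> treats \<open>a < 1\<close>, \<open>a = 1\<close> and \<open>a > 1\<close> alike: the
  growing factor \<open>n powr (2 * b)\<close> is bounded by its value at \<open>R\<close>, and the rest is a convergent series.
\<close>

lemma sum_fourier_coeff_le:
  fixes a b K :: real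
  assumes prob: "prob_space \<mu>" and "K > 0" and b: "b > (1 - a) / 2" "b \<ge> 0"
    and decay: "\<And>n::int. n \<noteq> 0 \<Longrightarrow> norm (fourier_coeff \<mu> n) \<le> K * \<bar>real_of_int n\<bar> powr (- a)"
  obtains C where "C \<ge> 0"
    and "\<And>R::nat. R \<ge> 1 \<Longrightarrow> (\<Sum>j=- int R..int R. norm (fourier_coeff \<mu> j)) \<le> C * real R powr (2 * b)"
proof -
  define e where "e = 2 * b + a"
  have e: "e > 1" using b by (simp add: e_def field_simps)
  define Z where "Z = (\<Sum>n. real (Suc n) powr (- e))"
  have sumZ: "summable (\<lambda>n. real (Suc n) powr (- e))"
    using e by (subst summable_Suc_iff) (simp add: summable_real_powr_iff)
  have Z0: "0 \<le> Z" unfolding Z_def by (intro suminf_nonneg sumZ) simp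
  interpret prob_space \<mu> by (rule prob)
  have zero: "norm (fourier_coeff \<mu> 0) \<le> 1"
  proof -
    have "character 0 t = 1" for t by transfer simp
    then show ?thesis by (simp add: fourier_coeff_def prob_space)
  qed
  show ?thesis
  proof
    show "0 \<le> 1 + 2 * K * Z" using Z0 \<open>K > 0\<close> by simp
    fix R :: nat assume R: "R \<ge> 1"
    let ?\<phi> = "\<lambda>j. norm (fourier_coeff \<mu> j)" and ?P = "real R powr (2 * b)"
    have decay_term: "?\<phi> j \<le> K * (?P * real n powr (- e))" if "\<bar>j\<bar> = int n" "1 \<le> n" "n \<le> R" for j n
    proof -
      have "?\<phi> j \<le> K * \<bar>real_of_int j\<bar> powr (- a)" by (rule decay) (use that in auto)
      also have "\<bar>real_of_int j\<bar> = real n"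
        using that(1) by linarith
      also have "real n powr (- a) = real n powr (2 * b) * real n powr (- e)"
        by (simp add: e_def flip: powr_add)
      also have "K * \<dots> \<le> K * (?P * real n powr (- e))"
        using that b \<open>K > 0\<close> by (intro mult_left_mono mult_right_mono powr_mono2) auto
      finally show ?thesis .
    qed
    have split: "{- int R..int R} = insert 0 (int ` {1..R} \<union> (\<lambda>n. - int n) ` {1..R})"
    proof (intro set_eqI iffI)
      fix j assume j: "j \<in> {- int R..int R}"
      consider "j = 0" | "j = int (nat j)" "nat j \<in> {1..R}" | "j = - int (nat (- j))" "nat (- j) \<in> {1..R}"
        using j by (cases j "0::int" rule: linorder_cases) (auto simp: nat_le_iff)
      then show "j \<in> insert 0 (int ` {1..R} \<union> (\<lambda>n. - int n) ` {1..R})"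
        by cases blast+
    qed auto
    have half: "(\<Sum>n=1..R. real n powr (- e)) \<le> Z"
    proof -
      have "(\<Sum>n=1..R. real n powr (- e)) = (\<Sum>n<R. real (Suc n) powr (- e))"
        using sum.atLeast_Suc_atMost_Suc_shift[of "\<lambda>n. real n powr (- e)" 0 "R - 1"] R
        by (simp add: lessThan_Suc_atMost[symmetric] atLeast0AtMost)
      also have "\<dots> \<le> Z" unfolding Z_def by (intro sum_le_suminf sumZ) auto
      finally show ?thesis .
    qed
    have "(\<Sum>j=- int R..int R. ?\<phi> j) =
        ?\<phi> 0 + ((\<Sum>n=1..R. ?\<phi> (int n)) + (\<Sum>n=1..R. ?\<phi> (- int n)))"
      unfolding split
      by (subst sum.insert; (subst sum.union_disjoint)?) (auto simp: sum.reindex inj_on_def)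
    also have "\<dots> \<le> 1 + ((\<Sum>n=1..R. K * (?P * real n powr (- e))) + (\<Sum>n=1..R. K * (?P * real n powr (- e))))"
      by (intro add_mono sum_mono zero decay_term) auto
    also have "\<dots> = 1 + 2 * K * ?P * (\<Sum>n=1..R. real n powr (- e))"
      by (simp add: sum_distrib_left mult.assoc)
    also have "\<dots> \<le> ?P + 2 * K * ?P * Z"
      using half R b \<open>K > 0\<close> by (intro add_mono mult_left_mono ge_one_powr_ge_zero) auto
    also have "\<dots> = (1 + 2 * K * Z) * ?P" by (simp add: algebra_simps)
    finally show "(\<Sum>j=- int R..int R. ?\<phi> j) \<le> (1 + 2 * K * Z) * ?P" .
  qed
qed

section \<open>Pairing opposite frequencies\<close>

lemma sum_shells:
  fixes g :: "int \<Rightarrow> 'a::comm_monoid_add"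
  shows "(\<Sum>n=m..<p. \<Sum>i\<in>{i. nat \<bar>i\<bar> = n}. g i) = (\<Sum>i\<in>{i. m \<le> nat \<bar>i\<bar> \<and> nat \<bar>i\<bar> < p}. g i)"
proof -
  let ?S = "{i. m \<le> nat \<bar>i\<bar> \<and> nat \<bar>i\<bar> < p}"
  have "finite ?S" by (rule finite_subset[of _ "{- int p..int p}"]) auto
  then have "(\<Sum>n=m..<p. \<Sum>i\<in>{i \<in> ?S. nat \<bar>i\<bar> = n}. g i) = sum g ?S"
    by (intro sum.group) auto
  moreover have "{i \<in> ?S. nat \<bar>i\<bar> = n} = {i. nat \<bar>i\<bar> = n}" if "n \<in> {m..<p}" for n
    using that by auto
  ultimately show ?thesis by simp
qed

text \<open>
  On the block of frequencies \<open>2 ^ k \<le> \<bar>i\<bar> < 2 ^ Suc k\<close> the weights \<open>(k + 1)\<^sup>2\<close> and \<open>(2 ^ k) powr (2 * b)\<close>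
  are at most \<open>4 * (log 2 (\<bar>i\<bar> + 1))\<^sup>2\<close> and \<open>\<bar>i\<bar> powr (2 * b)\<close>, and the blocks are disjoint.
\<close>

lemma summable_weighted_shell_blocks:
  fixes v :: "int \<Rightarrow> real" and b :: real
  assumes v: "\<And>i. v i \<ge> 0" and b: "b \<ge> 0"
    and sum: "(\<lambda>n::int. v n * \<bar>real_of_int n\<bar> powr (2 * b) * (log 2 (\<bar>real_of_int n\<bar> + 1))\<^sup>2) summable_on UNIV"
  shows "summable (\<lambda>k. (real k + 1)\<^sup>2 * ((2 ^ k) powr (2 * b)
    * (\<Sum>n=2 ^ k..<2 ^ Suc k. \<Sum>i\<in>{i. nat \<bar>i\<bar> = n}. v i)))"
proof -
  define u where "u = (\<lambda>n::int. v n * \<bar>real_of_int n\<bar> powr (2 * b) * (log 2 (\<bar>real_of_int n\<bar> + 1))\<^sup>2)"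
  have u0: "0 \<le> u i" for i unfolding u_def using v by simp
  define B where "B k = (\<Sum>n=2 ^ k..<2 ^ Suc k. \<Sum>i\<in>{i. nat \<bar>i\<bar> = n}. u i)" for k :: nat
  have "summable B"
  proof (rule summableI_nonneg_bounded)
    show "0 \<le> B k" for k unfolding B_def by (intro sum_nonneg u0)
    fix N
    have "(\<Sum>k<N. B k) = (\<Sum>n=1..<2 ^ N. \<Sum>i\<in>{i. nat \<bar>i\<bar> = n}. u i)"
    proof (induction N)
      case (Suc N)
      then show ?case
        unfolding sum.lessThan_Suc B_def by (simp add: sum.atLeastLessThan_concat)
    qed simp
    also have "\<dots> \<le> infsum u UNIV"
      unfolding sum_shells
    proof (rule finite_sum_le_infsum)
      show "finite {i::int. 1 \<le> nat \<bar>i\<bar> \<and> nat \<bar>i\<bar> < 2 ^ N}"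
        by (rule finite_subset[of _ "{- (2 ^ N)..2 ^ N}"]) (auto simp: nat_less_iff)
    qed (use sum u0 in \<open>auto simp: u_def\<close>)
    finally show "(\<Sum>k<N. B k) \<le> infsum u UNIV" .
  qed
  then have "summable (\<lambda>k. 4 * B k)" by (rule summable_mult)
  then show ?thesis
  proof (rule summable_comparison_test'[where N = 0])
    fix k :: nat
    have le: "(real k + 1)\<^sup>2 * ((2 ^ k) powr (2 * b) * v i) \<le> 4 * u i" if "2 ^ k \<le> nat \<bar>i\<bar>" for i
    proof -
      have i: "(2::real) ^ k \<le> \<bar>real_of_int i\<bar>"
      proof -
        have "int (2 ^ k) \<le> \<bar>i\<bar>" using that by (simp only: le_nat_iff abs_ge_zero)
        then have "real_of_int (int (2 ^ k)) \<le> real_of_int \<bar>i\<bar>" by (simp only: of_int_le_iff)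
        then show ?thesis by simp
      qed
      \<comment> \<open>for \<open>k = 0\<close> the shift by one inside the logarithm is essential: it gives \<open>log 2 2 = 1\<close> at \<open>\<bar>i\<bar> = 1\<close>\<close>
      have "real k + 1 \<le> 2 * log 2 (\<bar>real_of_int i\<bar> + 1)"
      proof (cases "k = 0")
        case True
        have "log 2 2 \<le> log 2 (\<bar>real_of_int i\<bar> + 1)"
          using i True by (intro log_mono) auto
        moreover have "log 2 2 = (1::real)" by simp
        ultimately show ?thesis using True by linarith
      next
        case False
        have "log 2 (2 ^ k) \<le> log 2 (\<bar>real_of_int i\<bar> + 1)"
          using i by (intro log_mono) auto
        then have "real k \<le> log 2 (\<bar>real_of_int i\<bar> + 1)" by (simp add: log_nat_power)
        then show ?thesis using False by simp
      qed
      then have "(real k + 1)\<^sup>2 * ((2 ^ k) powr (2 * b) * v i)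
          \<le> (2 * log 2 (\<bar>real_of_int i\<bar> + 1))\<^sup>2 * (\<bar>real_of_int i\<bar> powr (2 * b) * v i)"
        using i b v by (intro mult_mono power_mono powr_mono2) auto
      also have "\<dots> = 4 * u i" by (simp add: u_def power_mult_distrib)
      finally show ?thesis .
    qed
    have "(real k + 1)\<^sup>2 * ((2 ^ k) powr (2 * b)
        * (\<Sum>n=2 ^ k..<2 ^ Suc k. \<Sum>i\<in>{i. nat \<bar>i\<bar> = n}. v i)) \<le> 4 * B k"
      unfolding B_def sum_shells sum_distrib_left by (intro sum_mono le) auto
    then show "norm ((real k + 1)\<^sup>2 * ((2 ^ k) powr (2 * b)
        * (\<Sum>n=2 ^ k..<2 ^ Suc k. \<Sum>i\<in>{i. nat \<bar>i\<bar> = n}. v i))) \<le> 4 * B k"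
      by (simp add: sum_nonneg v)
  qed
qed

section \<open>Convergence of the trigonometric series\<close>

theorem corollary4:
  fixes \<mu> :: "torus measure" and c :: "int \<Rightarrow> complex" and K a :: real
  assumes "prob_space \<mu>" and "sets \<mu> = sets borel"
    and "K > 0" and "a \<ge> 0"
    and "\<And>n::int. n \<noteq> 0 \<Longrightarrow> norm (fourier_coeff \<mu> n) \<le> K * \<bar>real_of_int n\<bar> powr (- a)"
    and "\<exists>b::real. b > (1 - a) / 2 \<and> b \<ge> 0 \<and>
      (\<lambda>n::int. (norm (c n))\<^sup>2 * \<bar>real_of_int n\<bar> powr (2 * b)
        * (log 2 (\<bar>real_of_int n\<bar> + 1))\<^sup>2) summable_on UNIV"
  shows "AE t in \<mu>. convergent (\<lambda>N::nat. \<Sum>n = - int N..int N. c n * character n t)"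
proof -
  obtain b where b: "b > (1 - a) / 2" "b \<ge> 0" and sum: "(\<lambda>n::int. (norm (c n))\<^sup>2
      * \<bar>real_of_int n\<bar> powr (2 * b) * (log 2 (\<bar>real_of_int n\<bar> + 1))\<^sup>2) summable_on UNIV"
    using assms(6) by blast
  obtain C where C: "C \<ge> 0"
    "\<And>R::nat. R \<ge> 1 \<Longrightarrow> (\<Sum>j=- int R..int R. norm (fourier_coeff \<mu> j)) \<le> C * real R powr (2 * b)"
    using sum_fourier_coeff_le[OF assms(1,3) b assms(5)] by blast
  define f where "f n t = (\<Sum>i\<in>{i. nat \<bar>i\<bar> = n}. c i * character i t)" for n t
  define w where "w n = (\<Sum>i\<in>{i. nat \<bar>i\<bar> = n}. (norm (c i))\<^sup>2)" for n
  \<comment> \<open>frequencies in the \<open>k\<close>-th block differ by at most \<open>4 * 2 ^ k\<close>, whence the factor \<open>4 powr (2 * b)\<close>\<close>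
  define A where "A k = C * 4 powr (2 * b) * (2 ^ k) powr (2 * b)" for k :: nat
  have "AE t in \<mu>. convergent (\<lambda>N. \<Sum>n<N. f n t)"
  proof (rule Rademacher_Menshov_dyadic_blocks)
    show "integrable \<mu> (\<lambda>t. (norm (\<Sum>n=m..<p. f n t))\<^sup>2)" for m p
      unfolding f_def sum_shells by (rule integrable_norm_square_trigonometric_sum[OF assms(1,2)])
    have "summable (\<lambda>k. (real k + 1)\<^sup>2 * ((2 ^ k) powr (2 * b) * (\<Sum>n=2 ^ k..<2 ^ Suc k. w n)))"
      unfolding w_def by (rule summable_weighted_shell_blocks) (use b sum in auto)
    then have "summable (\<lambda>k. C * 4 powr (2 * b) * ((real k + 1)\<^sup>2
        * ((2 ^ k) powr (2 * b) * (\<Sum>n=2 ^ k..<2 ^ Suc k. w n))))"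
      by (rule summable_mult)
    then show "summable (\<lambda>k. (real k + 1)\<^sup>2 * (A k * (\<Sum>n=2 ^ k..<2 ^ Suc k. w n)))"
      by (simp add: A_def mult_ac)
  next
    fix k m p :: nat
    assume mp: "2 ^ k \<le> m" "p \<le> 2 ^ Suc k"
    let ?F = "{i. m \<le> nat \<bar>i\<bar> \<and> nat \<bar>i\<bar> < p}" and ?R = "4 * 2 ^ k :: nat"
    have "(\<integral>t. (norm (\<Sum>n=m..<p. f n t))\<^sup>2 \<partial>\<mu>)
        \<le> (\<Sum>j=- int ?R..int ?R. norm (fourier_coeff \<mu> j)) * (\<Sum>n=m..<p. w n)"
      unfolding f_def w_def sum_shells
    proof (rule integral_norm_square_trigonometric_sum_le[OF assms(1,2)])
      show "finite ?F" by (rule finite_subset[of _ "{- int p..int p}"]) auto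
      fix i j assume "i \<in> ?F" "j \<in> ?F"
      then have "nat \<bar>i\<bar> < 2 * 2 ^ k" "nat \<bar>j\<bar> < 2 * 2 ^ k" using mp by auto
      then have "\<bar>i\<bar> < 2 * 2 ^ k" "\<bar>j\<bar> < 2 * 2 ^ k" by (simp_all add: nat_less_iff)
      then show "\<bar>i - j\<bar> \<le> int ?R" by auto
    qed
    also have "\<dots> \<le> A k * (\<Sum>n=m..<p. w n)"
      using C(2)[of ?R]
      by (intro mult_right_mono) (auto simp: A_def powr_mult mult_ac w_def intro!: sum_nonneg)
    finally show "(\<integral>t. (norm (\<Sum>n=m..<p. f n t))\<^sup>2 \<partial>\<mu>) \<le> A k * (\<Sum>n=m..<p. w n)" .
  qed
  then show ?thesis
  proof eventually_elim
    case (elim t)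
    have "{i. 0 \<le> nat \<bar>i\<bar> \<and> nat \<bar>i\<bar> < Suc N} = {- int N..int N}" for N by auto
    then have "(\<Sum>n<Suc N. f n t) = (\<Sum>n = - int N..int N. c n * character n t)" for N
      unfolding f_def atLeast0LessThan[symmetric] sum_shells by simp
    moreover have "convergent (\<lambda>N. \<Sum>n<Suc N. f n t)"
      using elim convergent_Suc_iff[of "\<lambda>N. \<Sum>n<N. f n t"] by simp
    ultimately show ?case by simp
  qed
qed

end
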